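(* Let $L>0$ and let $K$ be the step-function kernel $K(t)=1$ for $t\in[0,L]$ and $K(t)=0$ for $t>L$. Let $T>0$. Then the modified cubic convolution spline scheme (cubic splines with parabolic runout conditions at $t=0$) with this kernel is stable; more precisely, there is a constant $C$ independent of $h$ and $n$ such that its stability coefficients satisfy $$|p_n|\le C\,6^{(T+1)/L}\qquad\text{for all } n\ge 0 \text{ with } nh\le T,$$ whenever $h>0$ is sufficiently small.
   Context: The scheme approximates the Volterra equation $\int_0^tK(t')\,u(t-t')\,dt'=a(t)$, $t\in[0,T]$. Basis functions. Define $b^0(\tau)=1$ for $\tau\in[0,1)$ and $0$ otherwise, and for $k\ge1$, $b^k(\tau)=\frac{\tau}{k}\,b^{k-1}(\tau)+\frac{k+1-\tau}{k}\,b^{k-1}(\tau-1)$. Let $B(t)=b^3(t+2)$ be the centred cubic B-spline, supported on $[-2,2]$. The modified cubic spline basis functions on $[0,\infty)$ are $$\phi_0(t)=B(t)+3B(t+1),\quad \phi_1(t)=B(t-1)-3B(t+1),\quad \phi_2(t)=B(t-2)+B(t+1),\quad \phi_j(t)=B(t-j)\ \ (j\ge3).$$ Scheme. With time step $h>0$ and $t_n=nh$, the weights are $q_j=\int_0^\infty K(t)\,\phi_j(t/h)\,dt$, and the scheme is $\sum_{j=0}^n q_j\,v_{n-j}=a(t_n)$. The stability coefficients are defined recursively by $p_0=1$ and $p_n=-\frac1{q_0}\sum_{j=1}^n q_j\,p_{n-j}$ for $n\ge1$. The scheme is called stable when $|p_n|\le C$ for all $n$ with $nh\le T$, where $C$ is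 independent of $h$. *)

theory Defs
  imports "HOL-Analysis.Analysis"
begin

fun bspline :: "nat \<Rightarrow> real \<Rightarrow> real" where
  "bspline 0 \<tau> = (if 0 \<le> \<tau> \<and> \<tau> < 1 then 1 else 0)"
| "bspline (Suc m) \<tau> =
     \<tau> / real (Suc m) * bspline m \<tau>
     + (real (Suc m) + 1 - \<tau>) / real (Suc m) * bspline m (\<tau> - 1)"

definition cubic_bspline :: "real \<Rightarrow> real" where
  "cubic_bspline t = bspline 3 (t + 2)"

text \<open>Parabolic runout at \<open>t = 0\<close> redistributes the spline centred at \<open>-1\<close> over the first three
  basis functions. These are only meaningful on \<open>t \<ge> 0\<close>, which is where the weights integrate them.\<close>

definition modified_basis :: "nat \<Rightarrow> real \<Rightarrow> real" where
  "modified_basis j t =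
     (if j = 0 then cubic_bspline t + 3 * cubic_bspline (t + 1)
      else if j = 1 then cubic_bspline (t - 1) - 3 * cubic_bspline (t + 1)
      else if j = 2 then cubic_bspline (t - 2) + cubic_bspline (t + 1)
      else cubic_bspline (t - real j))"

definition spline_weight :: "(real \<Rightarrow> real) \<Rightarrow> real \<Rightarrow> nat \<Rightarrow> real" where
  "spline_weight K h j = integral {0..} (\<lambda>t. K t * modified_basis j (t / h))"

fun stability_coeff :: "(real \<Rightarrow> real) \<Rightarrow> real \<Rightarrow> nat \<Rightarrow> real" where
  "stability_coeff K h 0 = 1"
| "stability_coeff K h (Suc n) =
     - (1 / spline_weight K h 0) *
       (\<Sum>j=1..Suc n. spline_weight K h j * stability_coeff K h (Suc n - j))"

definition stable_scheme :: "(real \<Rightarrow> real) \<Rightarrow> real \<Rightarrow> bool" where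
  "stable_scheme K T \<longleftrightarrow>
     (\<exists>C. \<forall>h>0. \<forall>n. real n * h \<le> T \<longrightarrow> \<bar>stability_coeff K h n\<bar> \<le> C)"

definition step_kernel :: "real \<Rightarrow> real \<Rightarrow> real" where
  "step_kernel L t = (if 0 \<le> t \<and> t \<le> L then 1 else 0)"

end

theory Submission
  imports Defs
begin

text \<open>
  Put \<open>x = L / h\<close>. Divided by \<open>h\<close>, the weights are \<open>5/8, 5/6, 25/24, 1, 1, \<dots>\<close> up to index about
  \<open>x - 2\<close>, decrease to \<open>0\<close> from there, and vanish from \<open>x + 2\<close> on. Subtracting consecutive
  convolution equations gives, with \<open>m\<close> about \<open>x - 1\<close> and \<open>n \<ge> 2\<close>,
  \<open>5/8 p n = - 5/24 p (n-1) - 5/24 p (n-2) + 1/24 p (n-3) + (\<Sum>j\<ge>m. r j * p (n-j))\<close>,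
  where \<open>r \<ge> 0\<close> has total mass at most \<open>1\<close>. As \<open>11/24 + 1/6 = 5/8\<close>, the bound \<open>C * 6 ^ (n div m)\<close>
  propagates, and \<open>n div m \<le> (T + 1) / L\<close> once \<open>h\<close> is small. For \<open>h\<close> bounded below only boundedly
  many steps are taken and the ratios \<open>q j / q 0\<close> are bounded, so a crude bound suffices.
\<close>

section \<open>Truncated powers and the cubic B-spline\<close>

definition truncated_power :: "nat \<Rightarrow> real \<Rightarrow> real" where
  "truncated_power k t = (max 0 t) ^ k"

text \<open>Away from \<open>0\<close> the function is locally zero or a monomial. At
  \<open>0\<close> the difference quotient is a truncated power of positive exponent and tends to
  \<open>0\<close>, which is why the exponent starts at 2.\<close>

lemma truncated_power_has_field_derivative:
  "(truncated_power (Suc (Suc k)) has_field_derivative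
     real (Suc (Suc k)) * truncated_power (Suc k) t) (at t)"
proof -
  consider "t < 0" | "t = 0" | "t > 0" by linarith
  then show ?thesis
  proof cases
    case 1
    have "((\<lambda>_. 0::real) has_field_derivative 0) (at t)" by simp
    then have "(truncated_power (Suc (Suc k)) has_field_derivative 0) (at t)"
      by (rule DERIV_cong_ev[THEN iffD1, rotated -1])
         (use 1 in \<open>auto simp: truncated_power_def max_def eventually_nhds intro!: exI[of _ "{..<0}"]\<close>)
    then show ?thesis using 1 by (simp add: truncated_power_def)
  next
    case 2
    have "(\<lambda>h. truncated_power (Suc k) h) \<midarrow>0\<rightarrow> truncated_power (Suc k) 0"
      unfolding truncated_power_def by (intro tendsto_intros)
    then have "(\<lambda>h. truncated_power (Suc (Suc k)) h / h) \<midarrow>0\<rightarrow> 0"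
      by (rule LIM_cong[THEN iffD1, rotated -1])
         (auto simp: truncated_power_def max_def)
    then show ?thesis using 2
      by (simp add: DERIV_def truncated_power_def)
  next
    case 3
    have "((\<lambda>t::real. t ^ Suc (Suc k)) has_field_derivative real (Suc (Suc k)) * t ^ Suc k) (at t)"
      by (rule derivative_eq_intros | simp)+
    then have "(truncated_power (Suc (Suc k)) has_field_derivative real (Suc (Suc k)) * t ^ Suc k) (at t)"
      by (rule DERIV_cong_ev[THEN iffD1, rotated -1])
         (use 3 in \<open>auto simp: truncated_power_def max_def eventually_nhds intro!: exI[of _ "{0<..}"]\<close>)
    then show ?thesis using 3 by (simp add: truncated_power_def max_def)
  qed
qed

lemma bspline_support: "\<tau> < 0 \<or> \<tau> \<ge> real m + 1 \<Longrightarrow> bspline m \<tau> = 0"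
  by (induction m arbitrary: \<tau>) (auto split: if_splits)

lemma bspline_nonneg: "bspline m \<tau> \<ge> 0"
proof (induction m arbitrary: \<tau>)
  case (Suc m)
  show ?case
  proof (cases "\<tau> < 0 \<or> \<tau> \<ge> real (Suc m) + 1")
    case True
    then show ?thesis using bspline_support[OF True] by simp
  next
    case False
    then show ?thesis using Suc[of \<tau>] Suc[of "\<tau> - 1"] by (auto intro!: add_nonneg_nonneg mult_nonneg_nonneg divide_nonneg_nonneg)
  qed
qed simp

lemma cubic_bspline_nonneg: "cubic_bspline t \<ge> 0"
  by (simp add: cubic_bspline_def bspline_nonneg)

text \<open>Both sides reduce to the same polynomial between consecutive knots. The right-hand side,
  a fourth finite difference, can be integrated without splitting at the knots.\<close>

lemma cubic_bspline_truncated_power: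
  "cubic_bspline t =
     (truncated_power 3 (t + 2) - 4 * truncated_power 3 (t + 1) + 6 * truncated_power 3 t
       - 4 * truncated_power 3 (t - 1) + truncated_power 3 (t - 2)) / 6"
proof -
  consider "t < -2" | "-2 \<le> t" "t < -1" | "-1 \<le> t" "t < 0" | "0 \<le> t" "t < 1" | "1 \<le> t" "t < 2" | "2 \<le> t"
    by linarith
  then show ?thesis
    by cases (auto simp: cubic_bspline_def truncated_power_def max_def eval_nat_numeral, (simp add: field_simps)+)
qed

section \<open>Antiderivative of the B-spline\<close>

text \<open>The integral of \<open>cubic_bspline\<close> over all points up to \<open>t\<close>: a
  distribution function rising from \<open>0\<close> at \<open>-2\<close> to \<open>1\<close> at
  \<open>2\<close>.\<close>

definition bspline_primitive :: "real \<Rightarrow> real" where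
  "bspline_primitive t =
     (truncated_power 4 (t + 2) - 4 * truncated_power 4 (t + 1) + 6 * truncated_power 4 t
       - 4 * truncated_power 4 (t - 1) + truncated_power 4 (t - 2)) / 24"

lemma bspline_primitive_has_field_derivative:
  "(bspline_primitive has_field_derivative cubic_bspline t) (at t)"
proof -
  have D: "((\<lambda>t. truncated_power 4 (t + c)) has_field_derivative 4 * truncated_power 3 (t + c)) (at t)" for c
    using truncated_power_has_field_derivative[of 2 "t + c"] by (simp add: DERIV_shift eval_nat_numeral)
  show ?thesis
    unfolding bspline_primitive_def cubic_bspline_truncated_power
    by (rule derivative_eq_intros D[of 2] D[of 1] D[of 0, simplified] D[of "-1", simplified] D[of "-2", simplified] refl | simp)+
qed

lemma bspline_primitive_mono: "s \<le> t \<Longrightarrow> bspline_primitive s \<le> bspline_primitive t"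
  by (erule DERIV_nonneg_imp_nondecreasing)
     (use bspline_primitive_has_field_derivative cubic_bspline_nonneg in blast)

lemma bspline_primitive_left: "t \<le> -2 \<Longrightarrow> bspline_primitive t = 0"
  by (simp add: bspline_primitive_def truncated_power_def max_def)

lemma bspline_primitive_right: "t \<ge> 2 \<Longrightarrow> bspline_primitive t = 1"
  by (simp add: bspline_primitive_def truncated_power_def max_def power4_eq_xxxx) (simp add: algebra_simps)

lemma bspline_primitive_bounds: "0 \<le> bspline_primitive t" "bspline_primitive t \<le> 1"
  using bspline_primitive_mono[of "min t (-2)" t] bspline_primitive_left[of "min t (-2)"]
    bspline_primitive_mono[of t "max t 2"] bspline_primitive_right[of "max t 2"] by auto

lemma bspline_primitive_values:
  "bspline_primitive (-1) = 1 / 24" "bspline_primitive 0 = 1 / 2" "bspline_primitive 1 = 23 / 24"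
  by (simp_all add: bspline_primitive_def truncated_power_def)

text \<open>An explicit quartic settles \<open>(0, 1]\<close>, and monotonicity the rest. Strictness
  keeps the leading weight away from \<open>0\<close> when \<open>h\<close> is not small.\<close>

lemma bspline_primitive_gt_half:
  assumes "0 < y"
  shows "bspline_primitive y > 1 / 2"
proof -
  define z where "z = min y 1"
  have z: "0 < z" "z \<le> 1" "z \<le> y" using assms by (auto simp: z_def)
  have "bspline_primitive z = 1 / 2 + z * (1 - z\<^sup>2) / 3 + z / 3 + z ^ 4 / 8"
    using z by (simp add: bspline_primitive_def truncated_power_def max_def eval_nat_numeral) (simp add: field_simps)
  moreover have "z * (1 - z\<^sup>2) \<ge> 0" using z by (simp add: power_le_one)
  moreover have "z ^ 4 \<ge> 0" by simp
  ultimately have "bspline_primitive z > 1 / 2" using z by linarith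
  then show ?thesis using bspline_primitive_mono[OF z(3)] by linarith
qed

section \<open>Weights of the step kernel\<close>

text \<open>The weight divided by the time step \<open>h\<close>, for the step kernel with \<open>x = L / h\<close>.\<close>

definition step_weight :: "real \<Rightarrow> nat \<Rightarrow> real" where
  "step_weight x j =
     (let F = \<lambda>c. bspline_primitive (x + c) - bspline_primitive c in
      if j = 0 then F 0 + 3 * F 1
      else if j = 1 then F (-1) - 3 * F 1
      else if j = 2 then F (-2) + F 1
      else F (- real j))"

lemma cubic_bspline_has_integral:
  assumes "0 < h" "0 \<le> L"
  shows "((\<lambda>t. cubic_bspline (t / h + c)) has_integral
    h * (bspline_primitive (L / h + c) - bspline_primitive c)) {0..L}"
proof -
  have "((\<lambda>t. cubic_bspline (t / h + c)) has_integral
    h * bspline_primitive (L / h + c) - h * bspline_primitive (0 / h + c)) {0..L}"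
  proof (rule fundamental_theorem_of_calculus[OF assms(2)])
    fix t
    have "((\<lambda>t. h * bspline_primitive (t / h + c)) has_field_derivative cubic_bspline (t / h + c)) (at t)"
      by (rule derivative_eq_intros DERIV_chain2[OF bspline_primitive_has_field_derivative] refl
          | use assms in simp)+
    then show "((\<lambda>t. h * bspline_primitive (t / h + c)) has_vector_derivative cubic_bspline (t / h + c))
        (at t within {0..L})"
      using has_real_derivative_iff_has_vector_derivative has_vector_derivative_at_within by blast
  qed
  then show ?thesis by (simp add: algebra_simps)
qed

lemma spline_weight_step_kernel:
  assumes "0 < h" "0 \<le> L"
  shows "spline_weight (step_kernel L) h j = h * step_weight (L / h) j"
proof -
  note I = cubic_bspline_has_integral[OF assms]
  have "((\<lambda>t. modified_basis j (t / h)) has_integral h * step_weight (L / h) j) {0..L}"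
  proof -
    consider "j = 0" | "j = 1" | "j = 2" | "j \<ge> 3" by linarith
    then show ?thesis
    proof cases
      case 1
      show ?thesis
        using has_integral_add[OF I[of 0] has_integral_mult_right[OF I[of 1], of 3]] 1
        by (simp add: modified_basis_def step_weight_def algebra_simps)
    next
      case 2
      show ?thesis
        using has_integral_diff[OF I[of "-1"] has_integral_mult_right[OF I[of 1], of 3]] 2
        by (simp add: modified_basis_def step_weight_def algebra_simps)
    next
      case 3
      show ?thesis
        using has_integral_add[OF I[of "-2"] I[of 1]] 3
        by (simp add: modified_basis_def step_weight_def algebra_simps)
    next
      case 4
      then show ?thesis
        using I[of "- real j"] by (simp add: modified_basis_def step_weight_def)
    qed
  qed
  then have "((\<lambda>t. if t \<in> {0..L} then modified_basis j (t / h) else 0) has_integral h * step_weight (L / h) j) {0..}"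
    by (subst has_integral_restrict) auto
  moreover have "(\<lambda>t. if t \<in> {0..L} then modified_basis j (t / h) else 0) =
      (\<lambda>t. step_kernel L t * modified_basis j (t / h))"
    by (auto simp: step_kernel_def)
  ultimately show ?thesis
    unfolding spline_weight_def by (simp add: integral_unique)
qed

text \<open>The support of a spline centred at \<open>j \<ge> 3\<close> lies in the positive
  half-line, so the lower boundary term vanishes.\<close>

lemma step_weight_ge3: "j \<ge> 3 \<Longrightarrow> step_weight x j = bspline_primitive (x - real j)"
  by (simp add: step_weight_def bspline_primitive_left)

text \<open>All shifts are at least \<open>-2\<close>, so \<open>x \<ge> 4\<close> makes every upper
  boundary term \<open>1\<close>; only values of the primitive at small integers remain.\<close>

lemma step_weight_initial:
  assumes "x \<ge> 4"
  shows "step_weight x 0 = 5 / 8" "step_weight x (Suc 0) = 5 / 6" "step_weight x 2 = 25 / 24"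
  using assms
  by (simp_all add: step_weight_def bspline_primitive_right bspline_primitive_left bspline_primitive_values)

text \<open>Each \<open>F c\<close> is at most 1 in absolute value, and the coefficients have
  absolute sum at most 4, attained for \<open>j = 0\<close> and \<open>j = 1\<close>.\<close>

lemma step_weight_abs_le: "\<bar>step_weight x j\<bar> \<le> 4"
proof -
  have "\<bar>bspline_primitive (x + c) - bspline_primitive c\<bar> \<le> 1" for c
    using bspline_primitive_bounds[of "x + c"] bspline_primitive_bounds[of c] by linarith
  from this[of 0] this[of 1] this[of "-1"] this[of "-2"] this[of "- real j"]
  show ?thesis unfolding step_weight_def Let_def abs_le_iff by (simp split: if_split)
qed

lemma step_weight_0_ge: "0 < y \<Longrightarrow> y \<le> x \<Longrightarrow> step_weight x 0 \<ge> bspline_primitive y - 1 / 2"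
  using bspline_primitive_mono[of y x] bspline_primitive_mono[of 1 "x + 1"]
  by (simp add: step_weight_def bspline_primitive_values)

section \<open>Convolution equations and their differences\<close>

lemma stability_coeff_convolution:
  assumes "\<And>j. spline_weight K h j = h * w j" "0 < h" "w 0 \<noteq> 0"
  shows "(\<Sum>j\<le>Suc n. w j * stability_coeff K h (Suc n - j)) = 0"
proof -
  have "w 0 * stability_coeff K h (Suc n) =
      - (\<Sum>j=1..Suc n. w j * stability_coeff K h (Suc n - j))"
    using assms(2,3) by (simp add: assms(1) mult.assoc sum_distrib_left[symmetric] del: sum.cl_ivl_Suc)
  moreover have "{..Suc n} = insert 0 {1..Suc n}" by auto
  ultimately show ?thesis by (simp del: sum.cl_ivl_Suc stability_coeff.simps)
qed

text \<open>Multiplying the generating function of the weights by \<open>1 - z\<close> turns the eventually constant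
  weights into a short polynomial plus a contribution supported where the kernel is cut off.\<close>

lemma stability_coeff_differenced:
  assumes "\<And>j. spline_weight K h j = h * w j" "0 < h" "w 0 \<noteq> 0" "n \<ge> 2"
  shows "w 0 * stability_coeff K h n = (\<Sum>j=1..n. (w (j - 1) - w j) * stability_coeff K h (n - j))"
proof -
  let ?p = "stability_coeff K h"
  obtain k where k: "n = Suc (Suc k)" using assms(4) by (metis Suc_le_D numeral_2_eq_2 Suc_le_mono)
  have "w 0 * ?p n + (\<Sum>j=1..n. w j * ?p (n - j)) = 0"
  proof -
    have "{..n} = insert 0 {1..n}" by auto
    then show ?thesis using stability_coeff_convolution[OF assms(1-3), of "Suc k"] k
      by (simp del: sum.cl_ivl_Suc stability_coeff.simps)
  qed
  \<comment> \<open>An index shift turns this into the convolution equation for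
    \<open>n - 1\<close>, which holds since \<open>n - 1 \<ge> 1\<close>.\<close>
  moreover have "(\<Sum>j=1..n. w (j - 1) * ?p (n - j)) = 0"
  proof -
    have "(\<Sum>j=1..n. w (j - 1) * ?p (n - j)) = (\<Sum>j\<le>Suc k. w j * ?p (Suc k - j))"
      unfolding k by (rule sum.reindex_bij_witness[where i = Suc and j = "\<lambda>j. j - 1"]) auto
    then show ?thesis using stability_coeff_convolution[OF assms(1-3), of k] by simp
  qed
  ultimately show ?thesis by (simp add: left_diff_distrib sum_subtractf)
qed

section \<open>Growth under a recursion with delay\<close>

text \<open>Strong induction by blocks of length \<open>m\<close>. Terms with delay below
  \<open>m\<close> are bounded at the level of \<open>n\<close>; longer delays reach at least one
  block back and gain a factor \<open>1 / \<rho>\<close>. Hence \<open>contract\<close> closes the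
  induction.\<close>

lemma delayed_recursion_bound:
  fixes p e :: "nat \<Rightarrow> real"
  assumes "m \<ge> 2" "a > 0" "\<rho> \<ge> 1" "C \<ge> 0"
    and init: "\<And>n. n < 2 \<Longrightarrow> \<bar>p n\<bar> \<le> C"
    and rec: "\<And>n. n \<ge> 2 \<Longrightarrow> a * \<bar>p n\<bar> \<le> (\<Sum>j=1..n. e j * \<bar>p (n - j)\<bar>)"
    and e_nonneg: "\<And>j. e j \<ge> 0"
    and near: "(\<Sum>j=1..<m. e j) \<le> A"
    and far: "\<And>n. n \<ge> m \<Longrightarrow> (\<Sum>j=m..n. e j) \<le> B"
    and contract: "A + B / \<rho> \<le> a" and "B \<ge> 0"
  shows "\<bar>p n\<bar> \<le> C * \<rho> ^ (n div m)"
proof (induction n rule: less_induct)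
  case (less n)
  show ?case
  proof (cases "n < 2")
    case True
    then show ?thesis using init[OF True] assms(1) by simp
  next
    case False
    define k where "k = n div m"
    have C\<rho>: "0 \<le> C * \<rho> ^ k" using assms by simp
    have A0: "A \<ge> 0" using near sum_nonneg[of "{1..<m}" e] e_nonneg by (meson order_trans)
    have nearb: "e j * \<bar>p (n - j)\<bar> \<le> e j * (C * \<rho> ^ k)" if "1 \<le> j" "j \<le> n" for j
    proof -
      have "\<bar>p (n - j)\<bar> \<le> C * \<rho> ^ ((n - j) div m)" using less[of "n - j"] that by simp
      also have "\<dots> \<le> C * \<rho> ^ k" unfolding k_def
        using assms by (intro mult_left_mono power_increasing div_le_mono) auto
      finally show ?thesis using e_nonneg by (intro mult_left_mono)
    qed
    have "(\<Sum>j=1..n. e j * \<bar>p (n - j)\<bar>) \<le> (A + B / \<rho>) * (C * \<rho> ^ k)"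
    proof (cases "n < m")
      case True
      have "(\<Sum>j=1..n. e j * \<bar>p (n - j)\<bar>) \<le> (\<Sum>j=1..n. e j) * (C * \<rho> ^ k)"
        unfolding sum_distrib_right by (intro sum_mono nearb) auto
      also have "(\<Sum>j=1..n. e j) \<le> (\<Sum>j=1..<m. e j)"
        by (rule sum_mono2) (use True e_nonneg in auto)
      also have "\<dots> \<le> A + B / \<rho>" using near assms by (simp add: add_increasing2)
      finally show ?thesis using C\<rho> by (meson mult_right_mono order_trans)
    next
      case nm: False
      then obtain k' where k': "k = Suc k'"
        using assms(1) unfolding k_def by (metis Suc_diff_1 div_greater_zero_iff not_less pos2 less_le_trans)
      have farb: "e j * \<bar>p (n - j)\<bar> \<le> e j * (C * \<rho> ^ k')" if "m \<le> j" "j \<le> n" for j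
      proof -
        \<comment> \<open>A delay of at least \<open>m\<close> lowers the block index by at least
          one.\<close>
        have "(n - j) div m \<le> (n - m) div m" using that by (intro div_le_mono) auto
        also have "\<dots> = k'" using nm k' assms(1) unfolding k_def by (simp add: le_div_geq)
        finally have "C * \<rho> ^ ((n - j) div m) \<le> C * \<rho> ^ k'"
          using assms by (intro mult_left_mono power_increasing) auto
        moreover have "\<bar>p (n - j)\<bar> \<le> C * \<rho> ^ ((n - j) div m)" using less[of "n - j"] that assms(1) by simp
        ultimately show ?thesis using e_nonneg by (intro mult_left_mono) auto
      qed
      have "{1..n} = {1..<m} \<union> {m..n}" using nm assms(1) by auto
      then have "(\<Sum>j=1..n. e j * \<bar>p (n - j)\<bar>) =
          (\<Sum>j=1..<m. e j * \<bar>p (n - j)\<bar>) + (\<Sum>j=m..n. e j * \<bar>p (n - j)\<bar>)"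
        by (simp add: sum.union_disjoint ivl_disj_int)
      also have "\<dots> \<le> (\<Sum>j=1..<m. e j) * (C * \<rho> ^ k) + (\<Sum>j=m..n. e j) * (C * \<rho> ^ k')"
        unfolding sum_distrib_right using nm by (intro add_mono sum_mono nearb farb) auto
      also have "\<dots> \<le> A * (C * \<rho> ^ k) + B * (C * \<rho> ^ k')"
        using nm C\<rho> assms by (intro add_mono mult_right_mono near far) auto
      also have "\<dots> = (A + B / \<rho>) * (C * \<rho> ^ k)"
        using assms(3) by (simp add: k' field_simps)
      finally show ?thesis .
    qed
    also have "\<dots> \<le> a * (C * \<rho> ^ k)" using contract C\<rho> by (intro mult_right_mono)
    finally have "a * \<bar>p n\<bar> \<le> a * (C * \<rho> ^ k)" using rec[of n] False by simp
    then show ?thesis using assms(2) by (simp add: k_def)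
  qed
qed

section \<open>Small steps: exponential bound for the step kernel\<close>

lemma stability_coeff_step_kernel_bound:
  assumes "0 < h" "0 < L" "6 \<le> L / h"
  shows "\<bar>stability_coeff (step_kernel L) h n\<bar> \<le> 4 / 3 * 6 ^ (n div (nat \<lfloor>L / h\<rfloor> - 1))"
proof -
  define x where "x = L / h"
  \<comment> \<open>With this \<open>m\<close>, every \<open>j < m\<close> has
    \<open>x - j \<ge> 2\<close>, so the weights from index 3 up to \<open>m - 1\<close> are exactly
    1.\<close>
  define m where "m = nat \<lfloor>x\<rfloor> - 1"
  let ?p = "stability_coeff (step_kernel L) h" and ?w = "step_weight x"
  define e where "e j = \<bar>?w (j - 1) - ?w j\<bar>" for j
  have x: "x \<ge> 6" using assms by (simp add: x_def)
  have m: "m \<ge> 5" "real m + 1 \<le> x" using x unfolding m_def by linarith+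
  have w: "spline_weight (step_kernel L) h j = h * ?w j" for j
    using spline_weight_step_kernel[of h L j] assms by (simp add: x_def)
  have w0: "?w 0 = 5 / 8" "?w (Suc 0) = 5 / 6" "?w 2 = 25 / 24"
    using step_weight_initial[of x] x by auto
  have w1: "?w j = 1" if "3 \<le> j" "j < m" for j
    using that m by (simp add: step_weight_ge3 bspline_primitive_right)
  have "\<bar>?p n\<bar> \<le> 4 / 3 * 6 ^ (n div m)"
  \<comment> \<open>Here \<open>a\<close> is the leading weight, \<open>A\<close> sums the early
    jumps 5/24, 5/24 and 1/24, and \<open>B\<close> bounds the descent from 1 to 0. With rate 6 the
    contraction is an equality. The constant \<open>4 / 3\<close> is the absolute value of
    \<open>?p 1\<close>, namely (5/6)/(5/8).\<close>
  proof (rule delayed_recursion_bound[where e = e and a = "5 / 8" and A = "11 / 24" and B = 1])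
    show "\<bar>?p n\<bar> \<le> 4 / 3" if "n < 2" for n
    proof -
      have "n = 0 \<or> n = Suc 0" using that by auto
      then show ?thesis using assms(1) w0 by (auto simp: w field_simps)
    qed
    show "5 / 8 * \<bar>?p n\<bar> \<le> (\<Sum>j=1..n. e j * \<bar>?p (n - j)\<bar>)" if "n \<ge> 2" for n
    proof -
      have "5 / 8 * ?p n = (\<Sum>j=1..n. (?w (j - 1) - ?w j) * ?p (n - j))"
        using stability_coeff_differenced[OF w assms(1) _ that] w0 by simp
      then have "5 / 8 * \<bar>?p n\<bar> = \<bar>\<Sum>j=1..n. (?w (j - 1) - ?w j) * ?p (n - j)\<bar>"
        by (metis abs_mult abs_of_nonneg divide_nonneg_nonneg zero_le_numeral)
      also have "\<dots> \<le> (\<Sum>j=1..n. e j * \<bar>?p (n - j)\<bar>)"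
        unfolding e_def abs_mult[symmetric] by (rule sum_abs)
      finally show ?thesis .
    qed
    show "(\<Sum>j=1..<m. e j) \<le> 11 / 24"
    proof -
      have e0: "e j = 0" if "4 \<le> j" "j < m" for j
        using w1[of j] w1[of "j - 1"] that by (simp add: e_def)
      have "(\<Sum>j=1..<m. e j) = (\<Sum>j\<in>{1,2,3}. e j)"
      proof (intro sum.mono_neutral_right ballI)
        fix j assume "j \<in> {1..<m} - {1, 2, 3}"
        then have "4 \<le> j" "j < m" by auto
        then show "e j = 0" by (rule e0)
      qed (use m in auto)
      also have "\<dots> = 11 / 24" using w0 w1[of 3] m by (simp add: e_def numeral_2_eq_2)
      finally show ?thesis by simp
    qed
    show "(\<Sum>j=m..n. e j) \<le> 1" if "n \<ge> m" for n
    proof -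
      \<comment> \<open>The weights are nonincreasing from index \<open>m - 1\<close> on, so the
        absolute differences telescope.\<close>
      have "(\<Sum>j=m..n. e j) = ?w (m - 1) - ?w n"
        using that
      proof (induction n rule: dec_induct)
        case base
        then show ?case using m bspline_primitive_mono[of "x - real m" "x - real (m - 1)"]
          by (simp add: e_def step_weight_ge3)
      next
        case (step n)
        then show ?case using m bspline_primitive_mono[of "x - real (Suc n)" "x - real n"]
          by (simp add: e_def step_weight_ge3)
      qed
      then show ?thesis
        using that m bspline_primitive_bounds[of "x - real n"] w1[of "m - 1"] by (simp add: step_weight_ge3)
    qed
  qed (use m in \<open>auto simp: e_def\<close>)
  then show ?thesis by (simp add: m_def x_def)
qed

section \<open>Large steps: crude geometric bound\<close>

text \<open>A discrete Gronwall argument: inserting the bound into the recursion gives a geometric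
  sum equal to \<open>(1 + E) ^ n - 1\<close> for \<open>n > 0\<close>.\<close>

lemma stability_coeff_geometric_bound:
  assumes "E \<ge> 0" "\<And>j. \<bar>spline_weight K h j\<bar> \<le> E * \<bar>spline_weight K h 0\<bar>"
  shows "\<bar>stability_coeff K h n\<bar> \<le> (1 + E) ^ n"
proof (induction n rule: less_induct)
  case (less n)
  show ?case
  proof (cases n)
    case (Suc k)
    let ?p = "stability_coeff K h" and ?q = "spline_weight K h"
    have "\<bar>?p n\<bar> = \<bar>\<Sum>j=1..Suc k. ?q j / ?q 0 * ?p (Suc k - j)\<bar>"
      unfolding Suc by (simp add: abs_mult sum_divide_distrib[symmetric] del: sum.cl_ivl_Suc)
    also have "\<dots> \<le> (\<Sum>j=1..Suc k. \<bar>?q j / ?q 0 * ?p (Suc k - j)\<bar>)" by (rule sum_abs)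
    also have "\<dots> \<le> (\<Sum>j=1..Suc k. E * (1 + E) ^ (Suc k - j))"
    proof (rule sum_mono)
      fix j assume j: "j \<in> {1..Suc k}"
      \<comment> \<open>If \<open>?q 0 = 0\<close>, the quotient is 0 by convention.\<close>
      have "\<bar>?q j / ?q 0\<bar> \<le> E"
        using assms(2)[of j] assms(1) by (cases "?q 0 = 0") (auto simp: field_simps)
      moreover have "\<bar>?p (Suc k - j)\<bar> \<le> (1 + E) ^ (Suc k - j)" using less[of "Suc k - j"] j Suc by simp
      ultimately show "\<bar>?q j / ?q 0 * ?p (Suc k - j)\<bar> \<le> E * (1 + E) ^ (Suc k - j)"
        unfolding abs_mult using assms(1) by (intro mult_mono) auto
    qed
    also have "\<dots> = E * (\<Sum>i<Suc k. (1 + E) ^ i)"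
      unfolding sum_distrib_left
      by (rule sum.reindex_bij_witness[where i = "\<lambda>i. Suc k - i" and j = "\<lambda>j. Suc k - j"]) auto
    also have "\<dots> = (1 + E) ^ Suc k - 1"
      using power_diff_1_eq[of "1 + E" "Suc k"] by simp
    finally show ?thesis using Suc by simp
  qed simp
qed

section \<open>Stability from the two step-size regimes\<close>

theorem mainTheorem4:
  fixes L T :: real
  assumes "L > 0" and "T > 0"
  shows "stable_scheme (step_kernel L) T \<and>
    (\<exists>C. \<exists>h0>0. \<forall>h. 0 < h \<and> h < h0 \<longrightarrow>
      (\<forall>n. real n * h \<le> T \<longrightarrow>
        \<bar>stability_coeff (step_kernel L) h n\<bar> \<le> C * 6 powr ((T + 1) / L)))"
proof -
  let ?p = "stability_coeff (step_kernel L)"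
  \<comment> \<open>The first bound gives \<open>L / h \<ge> 6\<close>. The second is
    \<open>2 * (T + 1) * h \<le> L\<close>, equivalent to
    \<open>T / (L - 2 * h) \<le> (T + 1) / L\<close> when \<open>L > 2 * h\<close>.\<close>
  define h0 where "h0 = min (L / 6) (L / (2 * (T + 1)))"
  define C where "C = 4 / 3 * 6 powr ((T + 1) / L)"
  have h0: "h0 > 0" using assms by (simp add: h0_def)
  have small: "\<bar>?p h n\<bar> \<le> C" if "0 < h" "h < h0" "real n * h \<le> T" for h n
  proof -
    define m where "m = nat \<lfloor>L / h\<rfloor> - 1"
    have x: "6 \<le> L / h" using that assms by (simp add: h0_def field_simps)
    have m: "real m \<ge> L / h - 2" "m > 0" using x unfolding m_def by linarith+
    have "real (n div m) \<le> real n / real m" by (rule of_nat_div_le_of_nat)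
    also have "\<dots> \<le> (T / h) / (L / h - 2)"
      using m x that assms by (intro frac_le) (auto simp: field_simps)
    also have "\<dots> \<le> (T + 1) / L"
    proof -
      have "2 * (T + 1) * h \<le> L" using that assms by (simp add: h0_def field_simps)
      moreover have "L - 2 * h > 0" using x that by (simp add: field_simps)
      ultimately show ?thesis using that assms by (simp add: divide_simps) (simp add: algebra_simps)
    qed
    finally have "(6::real) ^ (n div m) \<le> 6 powr ((T + 1) / L)"
      by (simp add: powr_realpow[symmetric] powr_mono)
    then show ?thesis
      using stability_coeff_step_kernel_bound[OF that(1) assms(1) x, of n] by (simp add: C_def m_def)
  qed
  \<comment> \<open>For \<open>n \<ge> 1\<close> the condition \<open>n * h \<le> T\<close> forces
    \<open>h \<le> T\<close>, so \<open>y\<close> bounds \<open>L / h\<close> from below.\<close>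
  define y where "y = L / T"
  \<comment> \<open>The uniform bound 4 on all weights over the lower bound on the leading
    one.\<close>
  define E where "E = 4 / (bspline_primitive y - 1 / 2)"
  have y: "y > 0" using assms by (simp add: y_def)
  have E: "E \<ge> 0" using bspline_primitive_gt_half[OF y] by (simp add: E_def)
  \<comment> \<open>Steps of size at least \<open>h0\<close> fit at most \<open>T / h0\<close> times
    into the interval.\<close>
  define N where "N = nat \<lceil>T / h0\<rceil>"
  have large: "\<bar>?p h n\<bar> \<le> (1 + E) ^ N" if h: "h0 \<le> h" "real n * h \<le> T" for h n
  proof (cases "n = 0")
    case True
    then show ?thesis using E by simp
  next
    case False
    have h': "0 < h" using h h0 by simp
    have "1 * h \<le> real n * h" using False h' by (intro mult_right_mono) auto
    then have "h \<le> T" using h by linarith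
    then have "y \<le> L / h" unfolding y_def using h' assms by (intro divide_left_mono) auto
    then have w0: "step_weight (L / h) 0 \<ge> bspline_primitive y - 1 / 2" by (rule step_weight_0_ge[OF y])
    have "\<bar>spline_weight (step_kernel L) h j\<bar> \<le> E * \<bar>spline_weight (step_kernel L) h 0\<bar>" for j
    proof -
      have "E * (bspline_primitive y - 1 / 2) = 4"
        using bspline_primitive_gt_half[OF y] unfolding E_def by (intro nonzero_eq_divide_eq[THEN iffD1]) auto
      then have "\<bar>step_weight (L / h) j\<bar> \<le> E * (bspline_primitive y - 1 / 2)"
        using step_weight_abs_le[of "L / h" j] by simp
      also have "\<dots> \<le> E * \<bar>step_weight (L / h) 0\<bar>" using w0 E by (intro mult_left_mono) auto
      finally show ?thesis
        using h' assms by (simp add: spline_weight_step_kernel abs_mult)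
    qed
    then have "\<bar>?p h n\<bar> \<le> (1 + E) ^ n" by (intro stability_coeff_geometric_bound E)
    also have "\<dots> \<le> (1 + E) ^ N"
    proof (rule power_increasing)
      have "real n * h0 \<le> real n * h" using h by (intro mult_left_mono) auto
      then have "real n \<le> T / h0" using h h0 by (simp add: field_simps)
      then show "n \<le> N" unfolding N_def by linarith
    qed (use E in simp)
    finally show ?thesis .
  qed
  have "\<bar>?p h n\<bar> \<le> max C ((1 + E) ^ N)" if "h > 0" "real n * h \<le> T" for h n
    using small[of h n] large[of h n] that by (cases "h < h0") auto
  then have "stable_scheme (step_kernel L) T"
    unfolding stable_scheme_def by blast
  moreover have "\<exists>C. \<exists>h0>0. \<forall>h. 0 < h \<and> h < h0 \<longrightarrow>
      (\<forall>n. real n * h \<le> T \<longrightarrow> \<bar>?p h n\<bar> \<le> C * 6 powr ((T + 1) / L))"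
    using small h0 unfolding C_def by blast
  ultimately show ?thesis by blast
qed

end
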